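(* Let $(A,\langle\cdot,\cdot\rangle)$ be a finite-dimensional symmetric Frobenius algebra over a field $\mathbf{k}$ of characteristic zero. A linear map $\mathcal R:A\to A$ is a skew-symmetric Rota-Baxter operator on $(A,\langle\cdot,\cdot\rangle)$ if and only if $\mathcal R$ is a Maurer-Cartan element of the graded Lie algebra $(\mathrm{C}^\bullet_{rb}(A),[\cdot,\cdot]_{rb})$.
   Context: A symmetric Frobenius algebra is an associative algebra $A$ with a non-degenerate symmetric bilinear form $\langle\cdot,\cdot\rangle$ that is invariant: $\langle xy,z\rangle=\langle x,yz\rangle$. A linear map $\mathcal R:A\to A$ is a Rota-Baxter operator if $\mathcal R(x)\mathcal R(y)=\mathcal R(\mathcal R(x)y+x\mathcal R(y))$ for all $x,y\in A$; it is skew-symmetric if $\langle\mathcal R(x),y\rangle=-\langle x,\mathcal R(y)\rangle$ for all $x,y$. For $p\ge0$ (with $\mathrm{Hom}(A^{\otimes0},A)=A$), $\mathrm{C}^p_{rb}(A)$ is the space of $F\in\mathrm{Hom}(A^{\otimes p},A)$ with $\langle F(x_1,\dots,x_p),x_0\rangle=(-1)^p\langle F(x_0,\dots,x_{p-1}),x_p\rangle$ for all $x_0,\dots,x_p\in A$ (degree $p$); $\mathrm{C}^\bullet_{rb}(A)=\bigoplus_{p\ge0}\mathrm{C}^p_{rb}(A)$. The graded Lie bracket $[\cdot,\cdot]_{rb}$: for $F\in\mathrm{Hom}(A^{\otimes p},A)$, $G\in\mathrm{Hom}(A^{\otimes q},A)$ with $p,q\ge1$, $[F,G]_{rb}:=F\circledcirc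 G-(-1)^{pq}G\circledcirc F$, where $$\begin{aligned}(F\circledcirc G)(x_1,\dots,x_{p+q})=&\sum_{i=1}^p(-1)^{(i-1)q}F(x_1,\dots,x_{i-1},G(x_i,\dots,x_{i+q-1})x_{i+q},x_{i+q+1},\dots,x_{p+q})\\&-\sum_{i=1}^p(-1)^{iq}F(x_1,\dots,x_{i-1},x_iG(x_{i+1},\dots,x_{i+q}),x_{i+q+1},\dots,x_{p+q})\\&+(-1)^{pq}F(x_1,\dots,x_p)G(x_{p+1},\dots,x_{p+q}).\end{aligned}$$ For $a\in A$ and $F\in\mathrm{Hom}(A^{\otimes p},A)$, $p\ge1$, $[F,a]_{rb}(x_1,\dots,x_p)=\sum_{i=1}^pF(x_1,\dots,x_{i-1},ax_i-x_ia,x_{i+1},\dots,x_p)+F(x_1,\dots,x_p)a-aF(x_1,\dots,x_p)$ and $[a,F]_{rb}=-[F,a]_{rb}$. For $a,b\in A$, $[a,b]_{rb}=ab-ba$. A Maurer-Cartan element of a graded Lie algebra (viewed as a dg Lie algebra with zero differential) is a degree $1$ element $x$ with $\frac12[x,x]=0$. *)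

theory Defs
  imports Complex_Main "HOL-Library.Function_Algebras"
begin

(* Algebras are not assumed to be unital: the multiplication is that of the class ring. *)

locale assoc_algebra = vector_space scale
  for scale :: "'k::field \<Rightarrow> 'a::ring \<Rightarrow> 'a" +
  assumes mult_scale_left: "scale c x * y = scale c (x * y)"
    and mult_scale_right: "x * scale c y = scale c (x * y)"

locale symmetric_frobenius_algebra = assoc_algebra scale
  for scale :: "'k::field \<Rightarrow> 'a::ring \<Rightarrow> 'a" +
  fixes form :: "'a \<Rightarrow> 'a \<Rightarrow> 'k"
  assumes form_linear_left: "Vector_Spaces.linear scale (*) (\<lambda>x. form x y)"
    and form_linear_right: "Vector_Spaces.linear scale (*) (\<lambda>y. form x y)"
    and form_sym: "form x y = form y x"
    and form_nondegenerate: "(\<And>y. form x y = 0) \<Longrightarrow> x = 0"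
    and form_invariant: "form (x * y) z = form x (y * z)"

definition rota_baxter :: "('a::ring \<Rightarrow> 'a) \<Rightarrow> bool" where
  "rota_baxter R \<longleftrightarrow> (\<forall>x y. R x * R y = R (R x * y + x * R y))"

definition skew_symmetric :: "('a \<Rightarrow> 'a \<Rightarrow> 'k::field) \<Rightarrow> ('a \<Rightarrow> 'a) \<Rightarrow> bool" where
  "skew_symmetric form R \<longleftrightarrow> (\<forall>x y. form (R x) y = - form x (R y))"

(* Hom(A^{\<otimes>p}, A) as the space of p-linear maps; the arguments (x_1, ..., x_p) form a list
   of length p.  The value 0 on lists of any other length makes the representation unique.
   For p = 0 the map F is the element F [] of A. *)

definition multilinear_maps ::
    "('k::field \<Rightarrow> 'a::ab_group_add \<Rightarrow> 'a) \<Rightarrow> nat \<Rightarrow> ('a list \<Rightarrow> 'a) set" where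
  "multilinear_maps scale p =
     {F. (\<forall>xs. length xs \<noteq> p \<longrightarrow> F xs = 0) \<and>
         (\<forall>xs i. length xs = p \<longrightarrow> i < p \<longrightarrow>
            Vector_Spaces.linear scale scale (\<lambda>y. F (xs[i := y])))}"

definition unary_map :: "('a \<Rightarrow> 'a::zero) \<Rightarrow> 'a list \<Rightarrow> 'a" where
  "unary_map R xs = (if length xs = 1 then R (hd xs) else 0)"

(* Here xs = [x_0, x_1, ..., x_p]. *)

definition crb ::
    "('k::field \<Rightarrow> 'a::ab_group_add \<Rightarrow> 'a) \<Rightarrow> ('a \<Rightarrow> 'a \<Rightarrow> 'k) \<Rightarrow> nat \<Rightarrow> ('a list \<Rightarrow> 'a) set" where
  "crb scale form p =
     {F \<in> multilinear_maps scale p.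
        \<forall>xs. length xs = p + 1 \<longrightarrow>
          form (F (tl xs)) (hd xs) = (- 1) ^ p * form (F (butlast xs)) (last xs)}"

(* Here xs = [x_1, ..., x_{p+q}], so x_i is xs ! (i - 1), the block x_1, ..., x_{i-1} is
   take (i - 1) xs, and x_i, ..., x_{i+q-1} is take q (drop (i - 1) xs). *)

definition rb_circ ::
    "('k::field \<Rightarrow> 'a::ring \<Rightarrow> 'a) \<Rightarrow> nat \<Rightarrow> nat \<Rightarrow> ('a list \<Rightarrow> 'a) \<Rightarrow> ('a list \<Rightarrow> 'a) \<Rightarrow> 'a list \<Rightarrow> 'a" where
  "rb_circ scale p q F G xs =
     (\<Sum>i = 1..p. scale ((- 1) ^ ((i - 1) * q))
        (F (take (i - 1) xs @ [G (take q (drop (i - 1) xs)) * xs ! (i + q - 1)] @ drop (i + q) xs)))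
   - (\<Sum>i = 1..p. scale ((- 1) ^ (i * q))
        (F (take (i - 1) xs @ [xs ! (i - 1) * G (take q (drop i xs))] @ drop (i + q) xs)))
   + scale ((- 1) ^ (p * q)) (F (take p xs) * G (drop p xs))"

definition rb_bracket_elem :: "nat \<Rightarrow> ('a::ring list \<Rightarrow> 'a) \<Rightarrow> 'a \<Rightarrow> 'a list \<Rightarrow> 'a" where
  "rb_bracket_elem p F a xs =
     (\<Sum>i = 1..p. F (xs[i - 1 := a * xs ! (i - 1) - xs ! (i - 1) * a])) + F xs * a - a * F xs"

(* The component Hom(A^{\<otimes>p}, A) x Hom(A^{\<otimes>q}, A) \<rightarrow> Hom(A^{\<otimes>(p+q)}, A) of the bracket. *)

definition rb_bracket ::
    "('k::field \<Rightarrow> 'a::ring \<Rightarrow> 'a) \<Rightarrow> nat \<Rightarrow> nat \<Rightarrow> ('a list \<Rightarrow> 'a) \<Rightarrow> ('a list \<Rightarrow> 'a) \<Rightarrow> 'a list \<Rightarrow> 'a" where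
  "rb_bracket scale p q F G xs =
     (if length xs \<noteq> p + q then 0
      else if p \<ge> 1 \<and> q \<ge> 1 then
        rb_circ scale p q F G xs - scale ((- 1) ^ (p * q)) (rb_circ scale q p G F xs)
      else if p \<ge> 1 then rb_bracket_elem p F (G []) xs
      else if q \<ge> 1 then - rb_bracket_elem q G (F []) xs
      else F [] * G [] - G [] * F [])"

definition pointwise_scale :: "('k \<Rightarrow> 'a \<Rightarrow> 'a) \<Rightarrow> 'k \<Rightarrow> ('b \<Rightarrow> 'a) \<Rightarrow> 'b \<Rightarrow> 'a" where
  "pointwise_scale scale c F = (\<lambda>x. scale c (F x))"

(* A graded Lie algebra is given by its homogeneous components C p, realised inside one
   ambient vector space, and by the components br p q : C p x C q \<rightarrow> C (p + q) of its bracket. *)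

definition maurer_cartan ::
    "('k::field \<Rightarrow> 'v::ab_group_add \<Rightarrow> 'v) \<Rightarrow> (nat \<Rightarrow> 'v set) \<Rightarrow>
     (nat \<Rightarrow> nat \<Rightarrow> 'v \<Rightarrow> 'v \<Rightarrow> 'v) \<Rightarrow> 'v \<Rightarrow> bool" where
  "maurer_cartan scale C br x \<longleftrightarrow> x \<in> C 1 \<and> scale (1 / 2) (br 1 1 x x) = 0"

end

theory Submission
  imports Defs
begin

text \<open>
  Membership in degree \<open>1\<close> and the Maurer-Cartan equation encode the two conditions on
  \<open>R\<close> separately. In degree \<open>1\<close> the cyclic condition reads
  \<open>\<langle>R x, y\<rangle> = - \<langle>R y, x\<rangle>\<close>, which by symmetry of the form is skew-symmetry of \<open>R\<close>
  (\<open>unary_map_in_crb_iff\<close>). For \<open>p = q = 1\<close> the sign \<open>(-1)\<^sup>p\<^sup>q\<close> is \<open>-1\<close>, so the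
  bracket of \<open>R\<close> with itself is twice \<open>R \<circledcirc> R\<close>; the factor \<open>1/2\<close> removes the \<open>2\<close>, and what
  remains is the defect of the Rota-Baxter identity
  (\<open>half_rb_bracket_unary_map\<close>).
\<close>

lemma (in assoc_algebra) unary_map_in_multilinear_maps:
  assumes "Vector_Spaces.linear scale scale R"
  shows "unary_map R \<in> multilinear_maps scale 1"
proof -
  have "(\<lambda>y. unary_map R (xs[i := y])) = R" if "length xs = 1" "i < 1" for xs i
    using that by (cases xs) (simp_all add: unary_map_def)
  moreover have "unary_map R xs = 0" if "length xs \<noteq> 1" for xs
    using that by (simp only: unary_map_def if_False)
  ultimately show ?thesis
    unfolding multilinear_maps_def mem_Collect_eq using assms by metis
qed

lemma (in symmetric_frobenius_algebra) unary_map_in_crb_iff: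
  assumes "Vector_Spaces.linear scale scale R"
  shows "unary_map R \<in> crb scale form 1 \<longleftrightarrow> skew_symmetric form R"
proof -
  have two: "(\<forall>xs::'a list. length xs = 1 + 1 \<longrightarrow> P xs) \<longleftrightarrow> (\<forall>x y. P [x, y])" for P
    by (simp add: length_Suc_conv) blast
  have "unary_map R \<in> crb scale form 1 \<longleftrightarrow> (\<forall>x y. form (R y) x = - form (R x) y)"
    unfolding crb_def mem_Collect_eq two
    using unary_map_in_multilinear_maps[OF assms] by (simp add: unary_map_def)
  also have "\<dots> \<longleftrightarrow> skew_symmetric form R"
    by (metis form_sym skew_symmetric_def)
  finally show ?thesis .
qed

lemma (in assoc_algebra) rb_circ_unary_map:
  assumes "Vector_Spaces.linear scale scale R"
  shows "rb_circ scale 1 1 (unary_map R) (unary_map R) [x, y] =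
    R (R x * y + x * R y) - R x * R y"
proof -
  interpret R: Vector_Spaces.linear scale scale R by (rule assms)
  show ?thesis by (simp add: rb_circ_def unary_map_def R.add)
qed

text \<open>Characteristic zero enters here: \<open>1/2\<close> has to be a genuine inverse of \<open>2\<close>.\<close>

lemma half_rb_bracket_unary_map:
  fixes scale :: "'k::field_char_0 \<Rightarrow> 'a::ring \<Rightarrow> 'a"
  assumes "assoc_algebra scale" and R: "Vector_Spaces.linear scale scale R"
  shows "scale (1 / 2) (rb_bracket scale 1 1 (unary_map R) (unary_map R) [x, y]) =
    R (R x * y + x * R y) - R x * R y"
proof -
  interpret assoc_algebra scale by fact
  let ?d = "R (R x * y + x * R y) - R x * R y"
  have "rb_bracket scale 1 1 (unary_map R) (unary_map R) [x, y] = ?d + ?d"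
    using rb_circ_unary_map[OF R, of x y]
    by (simp add: rb_bracket_def)
  also have "scale (1 / 2) (?d + ?d) = scale (1 / 2 + 1 / 2) ?d"
    by (simp only: scale_right_distrib scale_left_distrib)
  finally show ?thesis by simp
qed

lemma maurer_cartan_equation_iff_rota_baxter:
  fixes scale :: "'k::field_char_0 \<Rightarrow> 'a::ring \<Rightarrow> 'a"
  assumes A: "assoc_algebra scale" and R: "Vector_Spaces.linear scale scale R"
  shows "pointwise_scale scale (1 / 2) (rb_bracket scale 1 1 (unary_map R) (unary_map R)) = 0
    \<longleftrightarrow> rota_baxter R"
    (is "?b = 0 \<longleftrightarrow> _")
proof -
  interpret assoc_algebra scale by (rule A)
  have pair: "?b [x, y] = R (R x * y + x * R y) - R x * R y" for x y
    unfolding pointwise_scale_def by (rule half_rb_bracket_unary_map[OF A R])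
  have "?b zs = 0" if "length zs \<noteq> 2" for zs
    using that by (simp add: pointwise_scale_def rb_bracket_def numeral_2_eq_2)
  then have "?b = 0 \<longleftrightarrow> (\<forall>zs. length zs = 2 \<longrightarrow> ?b zs = 0)"
    by (auto simp: fun_eq_iff)
  also have "\<dots> \<longleftrightarrow> (\<forall>x y. ?b [x, y] = 0)"
    by (auto simp: length_Suc_conv numeral_2_eq_2)
  also have "\<dots> \<longleftrightarrow> rota_baxter R"
    unfolding pair rota_baxter_def right_minus_eq by metis
  finally show ?thesis .
qed

theorem corollary3p5:
  fixes scale :: "'k::field_char_0 \<Rightarrow> 'a::ring \<Rightarrow> 'a"
    and form :: "'a \<Rightarrow> 'a \<Rightarrow> 'k"
    and R :: "'a \<Rightarrow> 'a"
  assumes "symmetric_frobenius_algebra scale form"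
    and "\<exists>Basis. finite_dimensional_vector_space scale Basis"
    and "Vector_Spaces.linear scale scale R"
  shows "rota_baxter R \<and> skew_symmetric form R \<longleftrightarrow>
    maurer_cartan (pointwise_scale scale) (crb scale form) (rb_bracket scale) (unary_map R)"
proof -
  interpret symmetric_frobenius_algebra scale form by (rule assms(1))
  show ?thesis
    unfolding maurer_cartan_def unary_map_in_crb_iff[OF assms(3)]
      maurer_cartan_equation_iff_rota_baxter[OF assoc_algebra_axioms assms(3)]
    by (rule conj_commute)
qed

end
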